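(* Let $A=\{a_1,\ldots,a_k\}$, $k\ge 1$, be any ordered finite set of positive integers. Suppose $\tau=\tau_0\text{-}\phi$ is a partially ordered pattern, where $\tau_0$ is a consecutive pattern, $\phi$ is an arbitrary partially ordered pattern, and the letters of $\tau_0$ are incomparable to the letters of $\phi$. Then $$C_{\tau}^A(x,y)=C_{\tau_0}^A(x,y)+C_\phi^A(x,y)\,D_{\tau_0}^{A}(x,y).$$
   Context: A composition $\sigma=\sigma_1\ldots\sigma_m$ of $n$ with $m$ parts in $A$ is a sequence of $m$ elements of $A$ with sum $n$; the set of these is $C_{n;m}^A$. The empty composition ($n=m=0$) is included. An ordered set is a set whose elements are listed in increasing order. A partially ordered pattern (POP) $\tau$ is a word $\tau_1\ldots\tau_r$ of letters from a partially ordered alphabet (repeated letters allowed), possibly with dashes between some neighbouring letters. An occurrence of $\tau$ in $\sigma$ is a choice of positions $i_1<\cdots<i_r$ such that: $i_{p+1}=i_p+1$ whenever there is no dash between $\tau_p$ and $\tau_{p+1}$; $\sigma_{i_p}=\sigma_{i_q}$ whenever $\tau_p=\tau_q$; and $\sigma_{i_p}<\sigma_{i_q}$ whenever $\tau_p<\tau_q$ in the alphabet. No condition is imposed on the relative size of $\sigma_{i_p},\sigma_{i_q}$ when $\tau_p,\tau_q$ are incomparable. $\sigma$ avoids $\tau$ if it has no occurrence of $\tau$. A consecutive pattern is a dash-free word over the totally ordered alphabet $[\ell]=\{1,\dots,\ell\}$ containing each letter of $[\ell]$ at least once. In $\tau=\tau_0\text{-}\phi$ there is a dash between the last letter of $\tau_0$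 and the first letter of $\phi$, and the letters of $\tau_0$ and $\phi$ are taken from disjoint parts of the alphabet with every letter of $\tau_0$ incomparable to every letter of $\phi$ (the order relations inside $\tau_0$ and inside $\phi$ being kept). For a POP $\rho$, $C_{n;m}^A(\rho)$ is the set of $\sigma\in C_{n;m}^A$ avoiding $\rho$, and $C_\rho^A(x,y)=\sum_{n,m\ge0}|C_{n;m}^A(\rho)|x^ny^m$. A composition quasi-avoids a consecutive pattern $\tau_0$ if it has exactly one occurrence of $\tau_0$ and that occurrence consists of its $|\tau_0|$ rightmost parts, where $|\tau_0|$ is the number of letters of $\tau_0$; $D_{\tau_0}^A(x,y)=\sum_{n,m\geq 0}d_{n,m}x^ny^m$, where $d_{n,m}$ is the number of $\sigma\in C_{n;m}^A$ that quasi-avoid $\tau_0$. *)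

theory Defs
  imports "HOL-Computational_Algebra.Formal_Power_Series"
begin

definition compositions :: "nat set \<Rightarrow> nat \<Rightarrow> nat \<Rightarrow> nat list set" where
  "compositions A n m = {\<sigma>. set \<sigma> \<subseteq> A \<and> length \<sigma> = m \<and> sum_list \<sigma> = n}"

text \<open>
  A partially ordered pattern. Positions are counted from \<open>0\<close>; \<open>p \<in> dashes \<pi>\<close> means that there is
  a dash between the letters at positions \<open>p\<close> and \<open>p + 1\<close>. Members of \<open>dashes \<pi>\<close> to which no such
  pair of letters corresponds have no effect. The field \<open>letter_less\<close> is the strict order of the
  alphabet; only its restriction to the letters that occur in the word matters.
\<close>

record 'a pop =
  word :: "'a list"
  dashes :: "nat set"
  letter_less :: "'a \<Rightarrow> 'a \<Rightarrow> bool"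

definition is_pop :: "'a pop \<Rightarrow> bool" where
  "is_pop \<pi> \<longleftrightarrow>
     irreflp_on (set (word \<pi>)) (letter_less \<pi>) \<and> transp_on (set (word \<pi>)) (letter_less \<pi>)"

text \<open>An occurrence is identified with the list \<open>js\<close> of its positions in \<open>\<sigma>\<close>.\<close>

definition occurrence :: "'a pop \<Rightarrow> nat list \<Rightarrow> nat list \<Rightarrow> bool" where
  "occurrence \<pi> \<sigma> js \<longleftrightarrow>
     length js = length (word \<pi>) \<and> sorted_wrt (<) js \<and> (\<forall>j\<in>set js. j < length \<sigma>) \<and>
     (\<forall>p. Suc p < length (word \<pi>) \<and> p \<notin> dashes \<pi> \<longrightarrow> js ! Suc p = Suc (js ! p)) \<and>
     (\<forall>p<length (word \<pi>). \<forall>q<length (word \<pi>).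
        (word \<pi> ! p = word \<pi> ! q \<longrightarrow> \<sigma> ! (js ! p) = \<sigma> ! (js ! q)) \<and>
        (letter_less \<pi> (word \<pi> ! p) (word \<pi> ! q) \<longrightarrow> \<sigma> ! (js ! p) < \<sigma> ! (js ! q)))"

definition avoids :: "'a pop \<Rightarrow> nat list \<Rightarrow> bool" where
  "avoids \<pi> \<sigma> \<longleftrightarrow> \<not> (\<exists>js. occurrence \<pi> \<sigma> js)"

definition quasi_avoids :: "'a pop \<Rightarrow> nat list \<Rightarrow> bool" where
  "quasi_avoids \<pi> \<sigma> \<longleftrightarrow>
     (\<exists>!js. occurrence \<pi> \<sigma> js) \<and>
     occurrence \<pi> \<sigma> [length \<sigma> - length (word \<pi>)..<length \<sigma>]"

definition consecutive_pattern :: "nat pop \<Rightarrow> bool" where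
  "consecutive_pattern \<pi> \<longleftrightarrow>
     dashes \<pi> = {} \<and> letter_less \<pi> = (<) \<and> (\<exists>l\<ge>1. set (word \<pi>) = {1..l})"

text \<open>
  The pattern \<open>\<pi>-\<rho>\<close>, for nonempty \<open>\<pi>\<close>. The sum type makes the two alphabets disjoint, and
  \<^const>\<open>rel_sum\<close> keeps both orders while leaving letters of \<open>\<pi>\<close> and of \<open>\<rho>\<close> incomparable.
\<close>

definition dash_join :: "'a pop \<Rightarrow> 'b pop \<Rightarrow> ('a + 'b) pop" where
  "dash_join \<pi> \<rho> =
     \<lparr>word = map Inl (word \<pi>) @ map Inr (word \<rho>),
      dashes = {p \<in> dashes \<pi>. Suc p < length (word \<pi>)} \<union> {length (word \<pi>) - 1}
        \<union> (\<lambda>p. length (word \<pi>) + p) ` dashes \<rho>,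
      letter_less = rel_sum (letter_less \<pi>) (letter_less \<rho>)\<rparr>"

text \<open>
  Bivariate generating functions are formal power series in \<open>x\<close> (outer variable, exponent \<open>n\<close>)
  whose coefficients are formal power series in \<open>y\<close> (inner variable, exponent \<open>m\<close>).
\<close>

definition comp_gf :: "nat set \<Rightarrow> (nat list \<Rightarrow> bool) \<Rightarrow> int fps fps" where
  "comp_gf A P = Abs_fps (\<lambda>n. Abs_fps (\<lambda>m. int (card {\<sigma> \<in> compositions A n m. P \<sigma>})))"

definition C_gf :: "nat set \<Rightarrow> 'a pop \<Rightarrow> int fps fps" where
  "C_gf A \<pi> = comp_gf A (avoids \<pi>)"

definition D_gf :: "nat set \<Rightarrow> 'a pop \<Rightarrow> int fps fps" where
  "D_gf A \<pi> = comp_gf A (quasi_avoids \<pi>)"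

end

theory Submission
  imports Defs
begin

text \<open>
  If a composition contains \<open>\<pi>\<close>, then it has a shortest prefix \<open>\<alpha>\<close> containing \<open>\<pi>\<close>; write it as
  \<open>\<alpha> @ \<beta>\<close>. No occurrence of \<open>\<pi>\<close> ends before the last part of \<open>\<alpha>\<close>, so in any occurrence of
  the dashed pattern \<open>\<pi>-\<rho>\<close> the letters of \<open>\<rho>\<close> fall inside \<open>\<beta>\<close>. Conversely, since letters of
  \<open>\<pi>\<close> and \<open>\<rho>\<close> are incomparable, any occurrence of \<open>\<rho>\<close> in \<open>\<beta>\<close> joins an occurrence of \<open>\<pi>\<close> in
  \<open>\<alpha>\<close> to form an occurrence of \<open>\<pi>-\<rho>\<close>. Hence \<open>\<alpha> @ \<beta>\<close> avoids \<open>\<pi>-\<rho>\<close> exactly when \<open>\<beta>\<close>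
  avoids \<open>\<rho>\<close> (\<open>avoids_dash_join_iff\<close>).

  When \<open>\<pi>\<close> has no dashes, its occurrences are intervals of positions, and being a shortest
  prefix that contains \<open>\<pi>\<close> is the same as quasi-avoiding \<open>\<pi>\<close> (\<open>quasi_avoids_iff\<close>).
  The factorization \<open>\<alpha> @ \<beta>\<close> is unique, and both sum and length are additive under concatenation,
  so the compositions that contain \<open>\<pi>\<close> but avoid \<open>\<pi>-\<rho>\<close> are counted by a product of generating
  functions (\<open>comp_gf_mult\<close>).
\<close>

section \<open>Occurrences in concatenations\<close>

lemma occurrence_length: "occurrence \<pi> \<sigma> js \<Longrightarrow> length js = length (word \<pi>)"
  unfolding occurrence_def by blast

lemma occurrence_bound: "occurrence \<pi> \<sigma> js \<Longrightarrow> \<forall>j\<in>set js. j < length \<sigma>"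
  unfolding occurrence_def by blast

lemma occurrence_append_left:
  assumes "\<forall>j\<in>set js. j < length \<alpha>"
  shows "occurrence \<pi> (\<alpha> @ \<beta>) js \<longleftrightarrow> occurrence \<pi> \<alpha> js"
proof (cases "length js = length (word \<pi>)")
  case True
  have "(\<alpha> @ \<beta>) ! (js ! p) = \<alpha> ! (js ! p)" if "p < length (word \<pi>)" for p
    using assms that True by (auto simp: nth_append)
  with assms show ?thesis
    unfolding occurrence_def by (simp add: trans_less_add1)
qed (simp add: occurrence_def)

lemma occurrence_append_right:
  "occurrence \<pi> (\<alpha> @ \<beta>) (map ((+) (length \<alpha>)) js) \<longleftrightarrow> occurrence \<pi> \<beta> js"
proof (cases "length js = length (word \<pi>)")
  case True
  have "(\<alpha> @ \<beta>) ! (map ((+) (length \<alpha>)) js ! p) = \<beta> ! (js ! p)" if "p < length (word \<pi>)" for p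
    using that True by simp
  with True show ?thesis
    unfolding occurrence_def by (simp add: sorted_wrt_map)
qed (simp add: occurrence_def)

lemma avoids_append_leftD:
  assumes "avoids \<pi> (\<alpha> @ \<beta>)"
  shows "avoids \<pi> \<alpha>"
proof -
  have "occurrence \<pi> (\<alpha> @ \<beta>) js" if "occurrence \<pi> \<alpha> js" for js
    using that occurrence_append_left[OF occurrence_bound[OF that]] by blast
  with assms show ?thesis
    by (auto simp: avoids_def)
qed

lemma avoids_Nil: "word \<pi> \<noteq> [] \<Longrightarrow> avoids \<pi> []"
  using occurrence_length occurrence_bound unfolding avoids_def by fastforce

section \<open>Occurrences of dashed joins\<close>

text \<open>
  Incomparability of the two alphabets makes the conditions on the two halves independent: only
  their relative position in the composition couples them. The word of \<open>\<pi>\<close> has to be nonempty for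
  the joining dash to stand directly before the first letter of \<open>\<rho>\<close>.
\<close>

lemma occurrence_dash_join:
  assumes "length us = length (word \<pi>)" and "word \<pi> \<noteq> []"
  shows "occurrence (dash_join \<pi> \<rho>) \<sigma> (us @ vs) \<longleftrightarrow>
    occurrence \<pi> \<sigma> us \<and> occurrence \<rho> \<sigma> vs \<and> (\<forall>u\<in>set us. \<forall>v\<in>set vs. u < v)"
    (is "?L \<longleftrightarrow> ?R")
proof (cases "length vs = length (word \<rho>)")
  case lvs: True
  define k l where "k = length (word \<pi>)" and "l = length (word \<rho>)"
  let ?w = "map Inl (word \<pi>) @ map Inr (word \<rho>)"
  let ?js = "us @ vs"
  have k0: "k > 0" and lus: "length us = k" and lvs': "length vs = l"
    using assms lvs by (auto simp: k_def l_def)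
  have split: "(\<forall>p<k + l. Q p) \<longleftrightarrow> (\<forall>p<k. Q p) \<and> (\<forall>p<l. Q (k + p))" for Q
  proof -
    have "Q p" if "\<forall>p<k. Q p" "\<forall>p<l. Q (k + p)" "p < k + l" for p
      using that by (metis add_diff_inverse_nat nat_add_left_cancel_less)
    then show ?thesis by auto
  qed
  have wl: "?w ! p = Inl (word \<pi> ! p)" "?js ! p = us ! p" if "p < k" for p
    using that lus by (auto simp: nth_append k_def)
  have wr: "?w ! (k + p) = Inr (word \<rho> ! p)" "?js ! (k + p) = vs ! p" if "p < l" for p
    using that lus by (auto simp: nth_append k_def l_def)
  have dash_l: "p \<in> dashes (dash_join \<pi> \<rho>) \<longleftrightarrow> p \<in> dashes \<pi> \<or> Suc p = k" if "p < k" for p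
    using that k0 by (auto simp: dash_join_def k_def)
  have dash_r: "k + p \<in> dashes (dash_join \<pi> \<rho>) \<longleftrightarrow> p \<in> dashes \<rho>" for p
  proof -
    have "k + p \<noteq> k - 1"
      using k0 by linarith
    then show ?thesis
      by (auto simp: dash_join_def k_def)
  qed
  \<comment> \<open>The position \<open>k - 1\<close> carries the joining dash, so no adjacency condition crosses the halves.\<close>
  have adj: "(\<forall>p<k + l. Suc p < k + l \<and> p \<notin> dashes (dash_join \<pi> \<rho>) \<longrightarrow> ?js ! Suc p = Suc (?js ! p))
    \<longleftrightarrow> (\<forall>p<k. Suc p < k \<and> p \<notin> dashes \<pi> \<longrightarrow> us ! Suc p = Suc (us ! p)) \<and>
        (\<forall>p<l. Suc p < l \<and> p \<notin> dashes \<rho> \<longrightarrow> vs ! Suc p = Suc (vs ! p))"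
  proof -
    have "(Suc p < k + l \<and> p \<notin> dashes (dash_join \<pi> \<rho>) \<longrightarrow> ?js ! Suc p = Suc (?js ! p)) \<longleftrightarrow>
      (Suc p < k \<and> p \<notin> dashes \<pi> \<longrightarrow> us ! Suc p = Suc (us ! p))" if "p < k" for p
      using that dash_l[OF that] wl(2)[of p] wl(2)[of "Suc p"] by (cases "Suc p < k") auto
    moreover have "(Suc (k + p) < k + l \<and> k + p \<notin> dashes (dash_join \<pi> \<rho>)
        \<longrightarrow> ?js ! Suc (k + p) = Suc (?js ! (k + p))) \<longleftrightarrow>
      (Suc p < l \<and> p \<notin> dashes \<rho> \<longrightarrow> vs ! Suc p = Suc (vs ! p))" if "p < l" for p
      using that dash_r[of p] wr(2)[of p] wr(2)[of "Suc p"] by auto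
    ultimately show ?thesis
      unfolding split by simp
  qed
  have adj': "(\<forall>p. Suc p < n \<and> B p \<longrightarrow> H p) \<longleftrightarrow> (\<forall>p<n. Suc p < n \<and> B p \<longrightarrow> H p)"
    for n B H using Suc_lessD by blast
  have val: "(\<forall>p<k + l. \<forall>q<k + l. (?w ! p = ?w ! q \<longrightarrow> \<sigma> ! (?js ! p) = \<sigma> ! (?js ! q)) \<and>
      (rel_sum (letter_less \<pi>) (letter_less \<rho>) (?w ! p) (?w ! q) \<longrightarrow> \<sigma> ! (?js ! p) < \<sigma> ! (?js ! q)))
    \<longleftrightarrow> (\<forall>p<k. \<forall>q<k. (word \<pi> ! p = word \<pi> ! q \<longrightarrow> \<sigma> ! (us ! p) = \<sigma> ! (us ! q)) \<and>
      (letter_less \<pi> (word \<pi> ! p) (word \<pi> ! q) \<longrightarrow> \<sigma> ! (us ! p) < \<sigma> ! (us ! q))) \<and>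
      (\<forall>p<l. \<forall>q<l. (word \<rho> ! p = word \<rho> ! q \<longrightarrow> \<sigma> ! (vs ! p) = \<sigma> ! (vs ! q)) \<and>
      (letter_less \<rho> (word \<rho> ! p) (word \<rho> ! q) \<longrightarrow> \<sigma> ! (vs ! p) < \<sigma> ! (vs ! q)))"
    unfolding split by (simp add: wl wr)
  have fields: "word (dash_join \<pi> \<rho>) = ?w"
    "letter_less (dash_join \<pi> \<rho>) = rel_sum (letter_less \<pi>) (letter_less \<rho>)"
    by (simp_all add: dash_join_def)
  have lw: "length ?w = k + l" by (simp add: k_def l_def)
  show ?thesis
    unfolding occurrence_def fields lw adj' adj val k_def[symmetric] l_def[symmetric]
    by (simp only: sorted_wrt_append set_append ball_Un length_append lus lvs' simp_thms conj_ac)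
next
  case False
  then show ?thesis
    using assms(1) occurrence_length[of "dash_join \<pi> \<rho>" \<sigma> "us @ vs"]
      occurrence_length[of \<rho> \<sigma> vs]
    by (auto simp: dash_join_def)
qed

section \<open>Quasi-avoiding prefixes\<close>

lemma dash_free_occurrence_upt:
  assumes "occurrence \<pi> \<sigma> js" and "dashes \<pi> = {}" and "word \<pi> \<noteq> []"
  shows "js = [js ! 0..<js ! 0 + length (word \<pi>)]"
proof -
  have "js ! p = js ! 0 + p" if "p < length (word \<pi>)" for p
    using that
  proof (induction p)
    case (Suc p)
    then have "js ! Suc p = Suc (js ! p)"
      using assms(1,2) unfolding occurrence_def by blast
    with Suc show ?case by simp
  qed simp
  with occurrence_length[OF assms(1)] show ?thesis
    by (intro nth_equalityI) auto
qed

text \<open>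
  An occurrence of a dash-free pattern is determined by where it ends, so ``exactly one occurrence,
  at the far right'' says that every occurrence uses the last part. In this form quasi-avoidance
  refers only to containment, and it identifies the shortest prefixes containing the pattern.
\<close>

lemma quasi_avoids_iff:
  assumes "dashes \<pi> = {}" and "word \<pi> \<noteq> []"
  shows "quasi_avoids \<pi> \<alpha> \<longleftrightarrow> \<not> avoids \<pi> \<alpha> \<and> avoids \<pi> (butlast \<alpha>)"
proof
  let ?last = "[length \<alpha> - length (word \<pi>)..<length \<alpha>]"
  assume q: "quasi_avoids \<pi> \<alpha>"
  then have uniq: "js = ?last" if "occurrence \<pi> \<alpha> js" for js
    using that unfolding quasi_avoids_def by blast+
  have contains: "\<not> avoids \<pi> \<alpha>"
    using q unfolding quasi_avoids_def avoids_def by blast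
  then have ne: "\<alpha> \<noteq> []"
    using avoids_Nil[OF assms(2)] by blast
  have "\<not> occurrence \<pi> (butlast \<alpha>) js" for js
  proof
    assume js: "occurrence \<pi> (butlast \<alpha>) js"
    then have bound: "\<forall>j\<in>set js. j < length \<alpha> - 1"
      using occurrence_bound by fastforce
    then have "occurrence \<pi> \<alpha> js"
      using js occurrence_append_left[of js "butlast \<alpha>" \<pi> "[last \<alpha>]"] ne by simp
    then have "js = ?last"
      by (rule uniq)
    moreover have "length \<alpha> - 1 \<in> set ?last"
      using ne assms(2) by (cases "word \<pi>") auto
    ultimately show False
      using bound by blast
  qed
  with contains show "\<not> avoids \<pi> \<alpha> \<and> avoids \<pi> (butlast \<alpha>)"
    by (simp add: avoids_def)
next
  let ?last = "[length \<alpha> - length (word \<pi>)..<length \<alpha>]"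
  assume a: "\<not> avoids \<pi> \<alpha> \<and> avoids \<pi> (butlast \<alpha>)"
  then have ne: "\<alpha> \<noteq> []"
    using avoids_Nil[OF assms(2)] by blast
  have uniq: "js = ?last" if js: "occurrence \<pi> \<alpha> js" for js
  proof -
    obtain i where i: "js = [i..<i + length (word \<pi>)]"
      using dash_free_occurrence_upt[OF js assms] by blast
    have bound: "\<forall>j\<in>set js. j < length \<alpha>"
      using js by (rule occurrence_bound)
    have "\<not> (\<forall>j\<in>set js. j < length (butlast \<alpha>))"
      using a js occurrence_append_left[of js "butlast \<alpha>" \<pi> "[last \<alpha>]"] ne
      by (auto simp: avoids_def)
    then obtain j where "j \<in> set js" and "length \<alpha> - 1 \<le> j"
      by auto
    moreover have "i + length (word \<pi>) - 1 < length \<alpha>"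
      using bound assms(2) by (cases "word \<pi>") (auto simp: i)
    ultimately have "i + length (word \<pi>) = length \<alpha>"
      using i by auto
    moreover from this have "i = length \<alpha> - length (word \<pi>)"
      by simp
    ultimately show ?thesis
      using i by simp
  qed
  with a show "quasi_avoids \<pi> \<alpha>"
    unfolding quasi_avoids_def avoids_def by metis
qed

lemma contains_imp_quasi_avoiding_prefix:
  assumes "\<not> avoids \<pi> \<sigma>" and "dashes \<pi> = {}" and "word \<pi> \<noteq> []"
  obtains \<alpha> \<beta> where "\<sigma> = \<alpha> @ \<beta>" and "quasi_avoids \<pi> \<alpha>"
proof -
  define t where "t = (LEAST t. \<not> avoids \<pi> (take t \<sigma>))"
  have ex: "\<not> avoids \<pi> (take (length \<sigma>) \<sigma>)"
    using assms(1) by simp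
  then have t: "\<not> avoids \<pi> (take t \<sigma>)"
    unfolding t_def by (rule LeastI)
  have le: "t \<le> length \<sigma>"
    unfolding t_def using ex by (rule Least_le)
  have "t \<noteq> 0"
    using t avoids_Nil[OF assms(3)] by (metis take_0)
  then have "avoids \<pi> (take (t - 1) \<sigma>)"
    using not_less_Least[of "t - 1" "\<lambda>t. \<not> avoids \<pi> (take t \<sigma>)"] by (simp add: t_def)
  with t le have "quasi_avoids \<pi> (take t \<sigma>)"
    by (simp add: quasi_avoids_iff[OF assms(2,3)] butlast_take)
  then show thesis
    using that[of "take t \<sigma>" "drop t \<sigma>"] by simp
qed

lemma quasi_avoiding_prefix_unique:
  assumes "dashes \<pi> = {}" and "word \<pi> \<noteq> []"
    and "quasi_avoids \<pi> \<alpha>" and "quasi_avoids \<pi> \<alpha>'" and "\<alpha> @ \<beta> = \<alpha>' @ \<beta>'"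
  shows "\<alpha> = \<alpha>' \<and> \<beta> = \<beta>'"
proof -
  \<comment> \<open>A proper extension of \<open>\<gamma>\<close> still has \<open>\<gamma>\<close> as a prefix after its last part is removed.\<close>
  have no_ext: "\<delta> = []" if "quasi_avoids \<pi> \<gamma>" and "quasi_avoids \<pi> (\<gamma> @ \<delta>)" for \<gamma> \<delta>
  proof (rule ccontr)
    assume "\<delta> \<noteq> []"
    then have "avoids \<pi> (\<gamma> @ butlast \<delta>)"
      using that(2) by (simp add: quasi_avoids_iff[OF assms(1,2)] butlast_append)
    then have "avoids \<pi> \<gamma>"
      by (rule avoids_append_leftD)
    with that(1) show False
      by (simp add: quasi_avoids_iff[OF assms(1,2)])
  qed
  from assms(5) obtain \<delta> where "\<alpha> = \<alpha>' @ \<delta> \<and> \<delta> @ \<beta> = \<beta>' \<or> \<alpha> @ \<delta> = \<alpha>' \<and> \<beta> = \<delta> @ \<beta>'"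
    by (auto simp: append_eq_append_conv2)
  with no_ext assms(3,4) show ?thesis
    by force
qed

section \<open>Avoiding dashed joins\<close>

lemma avoids_dash_join_iff:
  assumes "dashes \<pi> = {}" and "word \<pi> \<noteq> []"
  shows "avoids (dash_join \<pi> \<rho>) \<sigma> \<longleftrightarrow>
    avoids \<pi> \<sigma> \<or> (\<exists>\<alpha> \<beta>. \<sigma> = \<alpha> @ \<beta> \<and> quasi_avoids \<pi> \<alpha> \<and> avoids \<rho> \<beta>)"
proof
  assume av: "avoids (dash_join \<pi> \<rho>) \<sigma>"
  show "avoids \<pi> \<sigma> \<or> (\<exists>\<alpha> \<beta>. \<sigma> = \<alpha> @ \<beta> \<and> quasi_avoids \<pi> \<alpha> \<and> avoids \<rho> \<beta>)"
  proof (cases "avoids \<pi> \<sigma>")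
    case False
    then obtain \<alpha> \<beta> where \<sigma>: "\<sigma> = \<alpha> @ \<beta>" and q: "quasi_avoids \<pi> \<alpha>"
      using contains_imp_quasi_avoiding_prefix assms by blast
    then obtain us where us: "occurrence \<pi> \<alpha> us"
      unfolding quasi_avoids_def by blast
    then have us_lt: "\<forall>u\<in>set us. u < length \<alpha>" and lus: "length us = length (word \<pi>)"
      using occurrence_bound occurrence_length by blast+
    have "\<not> occurrence \<rho> \<beta> vs" for vs
    proof
      assume "occurrence \<rho> \<beta> vs"
      then have "occurrence \<rho> \<sigma> (map ((+) (length \<alpha>)) vs)"
        by (simp add: \<sigma> occurrence_append_right)
      moreover have "occurrence \<pi> \<sigma> us"
        using us us_lt by (simp add: \<sigma> occurrence_append_left)
      ultimately have "occurrence (dash_join \<pi> \<rho>) \<sigma> (us @ map ((+) (length \<alpha>)) vs)"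
        using us_lt by (auto simp: occurrence_dash_join[OF lus assms(2)])
      with av show False
        by (auto simp: avoids_def)
    qed
    with \<sigma> q show ?thesis
      by (auto simp: avoids_def)
  qed simp
next
  assume R: "avoids \<pi> \<sigma> \<or> (\<exists>\<alpha> \<beta>. \<sigma> = \<alpha> @ \<beta> \<and> quasi_avoids \<pi> \<alpha> \<and> avoids \<rho> \<beta>)"
  have "\<not> occurrence (dash_join \<pi> \<rho>) \<sigma> js" for js
  proof
    assume js: "occurrence (dash_join \<pi> \<rho>) \<sigma> js"
    define us vs where "us = take (length (word \<pi>)) js" and "vs = drop (length (word \<pi>)) js"
    have lus: "length us = length (word \<pi>)"
      using occurrence_length[OF js] by (simp add: us_def dash_join_def)
    have "occurrence (dash_join \<pi> \<rho>) \<sigma> (us @ vs)"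
      using js by (simp add: us_def vs_def)
    then have us: "occurrence \<pi> \<sigma> us" and vs: "occurrence \<rho> \<sigma> vs"
      and lt: "\<forall>u\<in>set us. \<forall>v\<in>set vs. u < v"
      using occurrence_dash_join[OF lus assms(2)] by blast+
    from R us obtain \<alpha> \<beta> where \<sigma>: "\<sigma> = \<alpha> @ \<beta>" and q: "quasi_avoids \<pi> \<alpha>" and \<beta>: "avoids \<rho> \<beta>"
      by (auto simp: avoids_def)
    have q': "\<not> avoids \<pi> \<alpha>" "avoids \<pi> (butlast \<alpha>)"
      using q by (auto simp: quasi_avoids_iff[OF assms])
    then have "\<alpha> \<noteq> []"
      using avoids_Nil[OF assms(2)] by blast
    then have "\<sigma> = butlast \<alpha> @ last \<alpha> # \<beta>"
      by (simp add: \<sigma>)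
    then have "\<not> (\<forall>u\<in>set us. u < length (butlast \<alpha>))"
      using us q'(2) occurrence_append_left[of us "butlast \<alpha>" \<pi> "last \<alpha> # \<beta>"]
      by (auto simp: avoids_def)
    then obtain u where "u \<in> set us" "length \<alpha> - 1 \<le> u"
      by auto
    with lt have "length \<alpha> \<le> v" if "v \<in> set vs" for v
      using that by fastforce
    then have "map ((+) (length \<alpha>)) (map (\<lambda>v. v - length \<alpha>) vs) = vs"
      by (simp add: map_idI)
    then have "occurrence \<rho> \<beta> (map (\<lambda>v. v - length \<alpha>) vs)"
      using vs occurrence_append_right[of \<rho> \<alpha> \<beta> "map (\<lambda>v. v - length \<alpha>) vs"] by (simp add: \<sigma>)
    with \<beta> show False
      by (auto simp: avoids_def)
  qed
  then show "avoids (dash_join \<pi> \<rho>) \<sigma>"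
    by (simp add: avoids_def)
qed

section \<open>Generating functions of classes of compositions\<close>

lemma finite_compositions: "finite A \<Longrightarrow> finite (compositions A n m)"
  unfolding compositions_def
  by (rule finite_subset[OF _ finite_lists_length_eq[of A m]]) auto

lemma comp_gf_disj:
  assumes "finite A" and "\<And>\<sigma>. \<not> (P \<sigma> \<and> Q \<sigma>)"
  shows "comp_gf A (\<lambda>\<sigma>. P \<sigma> \<or> Q \<sigma>) = comp_gf A P + comp_gf A Q"
proof -
  have "card {\<sigma> \<in> compositions A n m. P \<sigma> \<or> Q \<sigma>} =
    card {\<sigma> \<in> compositions A n m. P \<sigma>} + card {\<sigma> \<in> compositions A n m. Q \<sigma>}" for n m
  proof -
    have "{\<sigma> \<in> compositions A n m. P \<sigma> \<or> Q \<sigma>} =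
      {\<sigma> \<in> compositions A n m. P \<sigma>} \<union> {\<sigma> \<in> compositions A n m. Q \<sigma>}"
      by blast
    then show ?thesis
      using assms finite_compositions[OF assms(1), of n m] by (simp add: card_Un_disjoint disjoint_iff)
  qed
  then show ?thesis
    by (simp add: comp_gf_def fps_eq_iff)
qed

text \<open>
  Unambiguous concatenation corresponds to multiplication, because concatenation adds both the sums
  and the numbers of parts.
\<close>

lemma comp_gf_mult:
  assumes "finite A"
    and unique: "\<And>\<alpha> \<beta> \<alpha>' \<beta>'. P \<alpha> \<Longrightarrow> Q \<beta> \<Longrightarrow> P \<alpha>' \<Longrightarrow> Q \<beta>' \<Longrightarrow> \<alpha> @ \<beta> = \<alpha>' @ \<beta>' \<Longrightarrow> \<alpha> = \<alpha>' \<and> \<beta> = \<beta>'"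
  shows "comp_gf A (\<lambda>\<sigma>. \<exists>\<alpha> \<beta>. \<sigma> = \<alpha> @ \<beta> \<and> P \<alpha> \<and> Q \<beta>) = comp_gf A P * comp_gf A Q"
proof -
  define X where "X P i j = {\<sigma> \<in> compositions A i j. P \<sigma>}" for P and i j :: nat
  have fin: "finite (X P i j)" for P i j
    unfolding X_def using finite_compositions[OF assms(1)] by simp
  have "card (X (\<lambda>\<sigma>. \<exists>\<alpha> \<beta>. \<sigma> = \<alpha> @ \<beta> \<and> P \<alpha> \<and> Q \<beta>) n m) =
    (\<Sum>i=0..n. \<Sum>j=0..m. card (X P i j) * card (X Q (n - i) (m - j)))" for n m
  proof -
    define S where "S = (SIGMA ij:{0..n} \<times> {0..m}.
      X P (fst ij) (snd ij) \<times> X Q (n - fst ij) (m - snd ij))"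
    define f :: "(nat \<times> nat) \<times> nat list \<times> nat list \<Rightarrow> nat list"
      where "f = (\<lambda>(ij, \<alpha>, \<beta>). \<alpha> @ \<beta>)"
    have inj: "inj_on f S"
    proof (rule inj_onI)
      fix s s' assume s: "s \<in> S" "s' \<in> S" and eq: "f s = f s'"
      obtain i j \<alpha> \<beta> where s1: "s = ((i, j), \<alpha>, \<beta>)" by (metis surj_pair)
      obtain i' j' \<alpha>' \<beta>' where s2: "s' = ((i', j'), \<alpha>', \<beta>')" by (metis surj_pair)
      have "\<alpha> = \<alpha>' \<and> \<beta> = \<beta>'"
        using s eq by (intro unique) (auto simp: s1 s2 S_def X_def f_def)
      \<comment> \<open>The indices are the sum and the length of \<open>\<alpha>\<close>.\<close>
      then show "s = s'"
        using s by (auto simp: s1 s2 S_def X_def compositions_def)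
    qed
    have "f ` S = X (\<lambda>\<sigma>. \<exists>\<alpha> \<beta>. \<sigma> = \<alpha> @ \<beta> \<and> P \<alpha> \<and> Q \<beta>) n m"
    proof (intro equalityI subsetI)
      fix \<sigma> assume "\<sigma> \<in> f ` S"
      then show "\<sigma> \<in> X (\<lambda>\<sigma>. \<exists>\<alpha> \<beta>. \<sigma> = \<alpha> @ \<beta> \<and> P \<alpha> \<and> Q \<beta>) n m"
        by (auto simp: S_def X_def f_def compositions_def)
    next
      fix \<sigma> assume "\<sigma> \<in> X (\<lambda>\<sigma>. \<exists>\<alpha> \<beta>. \<sigma> = \<alpha> @ \<beta> \<and> P \<alpha> \<and> Q \<beta>) n m"
      then obtain \<alpha> \<beta> where \<sigma>: "\<sigma> = \<alpha> @ \<beta>" "P \<alpha>" "Q \<beta>" "\<alpha> @ \<beta> \<in> compositions A n m"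
        by (auto simp: X_def)
      then have "((sum_list \<alpha>, length \<alpha>), \<alpha>, \<beta>) \<in> S"
        by (auto simp: S_def X_def compositions_def)
      then show "\<sigma> \<in> f ` S"
        by (rule rev_image_eqI) (simp add: f_def \<sigma>(1))
    qed
    then have "card (X (\<lambda>\<sigma>. \<exists>\<alpha> \<beta>. \<sigma> = \<alpha> @ \<beta> \<and> P \<alpha> \<and> Q \<beta>) n m) = card S"
      using card_image[OF inj] by simp
    also have "\<dots> = (\<Sum>i=0..n. \<Sum>j=0..m. card (X P i j) * card (X Q (n - i) (m - j)))"
      by (simp add: S_def fin sum.cartesian_product card_cartesian_product case_prod_unfold)
    finally show ?thesis .
  qed
  then show ?thesis
    by (simp add: comp_gf_def fps_eq_iff fps_mult_nth fps_sum_nth flip: X_def)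
qed

section \<open>The generating function of a dashed join\<close>

theorem theorem3p2:
  fixes A :: "nat set" and \<tau>\<^sub>0 :: "nat pop" and \<phi> :: "'b pop"
  assumes "finite A" and "A \<noteq> {}" and "\<forall>a\<in>A. 0 < a"
    and "consecutive_pattern \<tau>\<^sub>0" and "is_pop \<phi>"
  shows "C_gf A (dash_join \<tau>\<^sub>0 \<phi>) = C_gf A \<tau>\<^sub>0 + C_gf A \<phi> * D_gf A \<tau>\<^sub>0"
proof -
  have \<tau>\<^sub>0: "dashes \<tau>\<^sub>0 = {}" "word \<tau>\<^sub>0 \<noteq> []"
    using assms(4) by (auto simp: consecutive_pattern_def)
  let ?F = "\<lambda>\<sigma>. \<exists>\<alpha> \<beta>. \<sigma> = \<alpha> @ \<beta> \<and> quasi_avoids \<tau>\<^sub>0 \<alpha> \<and> avoids \<phi> \<beta>"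
  have "avoids (dash_join \<tau>\<^sub>0 \<phi>) = (\<lambda>\<sigma>. avoids \<tau>\<^sub>0 \<sigma> \<or> ?F \<sigma>)"
    by (rule ext) (rule avoids_dash_join_iff[OF \<tau>\<^sub>0])
  then have "C_gf A (dash_join \<tau>\<^sub>0 \<phi>) = comp_gf A (\<lambda>\<sigma>. avoids \<tau>\<^sub>0 \<sigma> \<or> ?F \<sigma>)"
    by (simp add: C_gf_def)
  also have "\<dots> = C_gf A \<tau>\<^sub>0 + comp_gf A ?F"
    unfolding C_gf_def
    using avoids_append_leftD quasi_avoids_iff[OF \<tau>\<^sub>0]
    by (intro comp_gf_disj[OF assms(1)]) blast
  also have "comp_gf A ?F = D_gf A \<tau>\<^sub>0 * C_gf A \<phi>"
    unfolding C_gf_def D_gf_def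
    using quasi_avoiding_prefix_unique[OF \<tau>\<^sub>0] by (intro comp_gf_mult[OF assms(1)])
  finally show ?thesis
    by (simp add: mult.commute)
qed

end
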